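(* Let $C$ be a curve in the Myller configuration $M(C,\bar\xi,\pi)$ with alternative frame $R_A$, with $(K_1,K_2)\neq(0,0)$, and with $q$ nowhere zero. Then $C$ is a Darboux helix if and only if the function $$f=\mp\frac{p}{q}=\mp\frac1\sigma,\qquad \sigma=\frac{K_1^2}{(K_1^2+K_2^2)^{3/2}}\left(\frac{K_2}{K_1}\right)',$$ is constant (where $\mp$ means one of the two signs, the same for all $s$).
   Context: All data are smooth. Let $C$ be a curve in Euclidean space $E^3$ with arclength parameter $s\in I$ ($I$ an interval) and position vector $\bar r(s)$, let $\bar\xi(s)$ be a unit vector field along $C$ (a versor field $(C,\bar\xi)$), and let $\pi(s)$ be a plane field along $C$ with $\bar\xi(s)\in\pi(s)$. The pair $((C,\bar\xi),(C,\pi))$ is called a Myller configuration $M=M(C,\bar\xi,\pi)$. Put $\bar\xi_1=\bar\xi$, $K_1=\|d\bar\xi/ds\|>0$ (curvature), define $\bar\xi_2$ by $\bar\xi_1'=K_1\bar\xi_2$, and $\bar\xi_3=\bar\xi_1\times\bar\xi_2$. Then $\{\bar\xi_1,\bar\xi_2,\bar\xi_3\}$ is a positively oriented orthonormal frame, the Frenet-type frame $R_F$, and $$\bar\xi_1'=K_1\bar\xi_2,\quad \bar\xi_2'=-K_1\bar\xi_1+K_2\bar\xi_3,\quad \bar\xi_3'=-K_2\bar\xi_2,$$ which defines the torsion $K_2$. A prime denotes $d/ds$. The alternative frame (AF-frame) is the orthonormal frame $R_A=\{P(s);\bar\xi_2,\bar Y,\bar D\}$ with $\bar Y=\bar\xi_2'/\|\bar\xi_2'\|$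 and $\bar D=\bar\xi_2\times\bar Y=\frac{K_2}{\sqrt{K_1^2+K_2^2}}\bar\xi_1+\frac{K_1}{\sqrt{K_1^2+K_2^2}}\bar\xi_3$. It satisfies $\bar\xi_2'=p\bar Y$, $\bar Y'=-p\bar\xi_2+q\bar D$, $\bar D'=-q\bar Y$, where the alternative curvatures are $p=\sqrt{K_1^2+K_2^2}$ and $q=\frac{K_1^2}{K_1^2+K_2^2}\left(\frac{K_2}{K_1}\right)'$. The curve $C$ is called a Darboux helix in $M$ if $\bar D$ makes a constant angle with a constant unit vector $\bar l$. *)

theory Defs
  imports "HOL-Analysis.Analysis"
begin

text \<open>The derivative is taken within the interval, hence one-sided at end points belonging to it.
  For a nondegenerate interval it is unique and depends on the values on the interval only.\<close>

definition deriv_along :: "real set \<Rightarrow> (real \<Rightarrow> 'a::real_normed_vector) \<Rightarrow> real \<Rightarrow> 'a" where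
  "deriv_along I f s = vector_derivative f (at s within I)"

definition smooth_along :: "real set \<Rightarrow> (real \<Rightarrow> 'a::real_normed_vector) \<Rightarrow> bool" where
  "smooth_along I f \<longleftrightarrow> (\<forall>n. (deriv_along I ^^ n) f differentiable_on I)"

text \<open>Planes are represented by their direction planes, the two-dimensional linear subspaces of
  the space of vectors. Over an interval, a plane field is smooth if and only if it has a smooth
  unit normal field.\<close>

definition smooth_plane_field :: "real set \<Rightarrow> (real \<Rightarrow> (real^3) set) \<Rightarrow> bool" where
  "smooth_plane_field I P \<longleftrightarrow>
     (\<exists>\<nu>. smooth_along I \<nu> \<and> (\<forall>s\<in>I. norm (\<nu> s) = 1 \<and> P s = {v. v \<bullet> \<nu> s = 0}))"

definition K1 :: "real set \<Rightarrow> (real \<Rightarrow> real^3) \<Rightarrow> real \<Rightarrow> real" where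
  "K1 I \<xi> s = norm (deriv_along I \<xi> s)"

text \<open>The standing assumption that the curvature is positive, without which the Frenet-type
  frame does not exist, is part of the notion of configuration.\<close>

definition myller_configuration ::
  "real set \<Rightarrow> (real \<Rightarrow> real^3) \<Rightarrow> (real \<Rightarrow> real^3) \<Rightarrow> (real \<Rightarrow> (real^3) set) \<Rightarrow> bool" where
  "myller_configuration I r \<xi> P \<longleftrightarrow>
     is_interval I \<and> interior I \<noteq> {} \<and>
     smooth_along I r \<and> (\<forall>s\<in>I. norm (deriv_along I r s) = 1) \<and>
     smooth_along I \<xi> \<and> (\<forall>s\<in>I. norm (\<xi> s) = 1) \<and>
     smooth_plane_field I P \<and> (\<forall>s\<in>I. \<xi> s \<in> P s) \<and>
     (\<forall>s\<in>I. K1 I \<xi> s > 0)"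

definition \<xi>2 :: "real set \<Rightarrow> (real \<Rightarrow> real^3) \<Rightarrow> real \<Rightarrow> real^3" where
  "\<xi>2 I \<xi> s = deriv_along I \<xi> s /\<^sub>R K1 I \<xi> s"

definition \<xi>3 :: "real set \<Rightarrow> (real \<Rightarrow> real^3) \<Rightarrow> real \<Rightarrow> real^3" where
  "\<xi>3 I \<xi> s = cross3 (\<xi> s) (\<xi>2 I \<xi> s)"

text \<open>The torsion is the coefficient of \<open>\<xi>3\<close> in the Frenet-type equation
  \<open>\<xi>2' = - K1 \<xi> + K2 \<xi>3\<close>.\<close>

definition K2 :: "real set \<Rightarrow> (real \<Rightarrow> real^3) \<Rightarrow> real \<Rightarrow> real" where
  "K2 I \<xi> s = deriv_along I (\<xi>2 I \<xi>) s \<bullet> \<xi>3 I \<xi> s"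

definition AF_Y :: "real set \<Rightarrow> (real \<Rightarrow> real^3) \<Rightarrow> real \<Rightarrow> real^3" where
  "AF_Y I \<xi> s = deriv_along I (\<xi>2 I \<xi>) s /\<^sub>R norm (deriv_along I (\<xi>2 I \<xi>) s)"

definition AF_D :: "real set \<Rightarrow> (real \<Rightarrow> real^3) \<Rightarrow> real \<Rightarrow> real^3" where
  "AF_D I \<xi> s = cross3 (\<xi>2 I \<xi> s) (AF_Y I \<xi> s)"

definition AF_p :: "real set \<Rightarrow> (real \<Rightarrow> real^3) \<Rightarrow> real \<Rightarrow> real" where
  "AF_p I \<xi> s = sqrt ((K1 I \<xi> s)\<^sup>2 + (K2 I \<xi> s)\<^sup>2)"

definition AF_q :: "real set \<Rightarrow> (real \<Rightarrow> real^3) \<Rightarrow> real \<Rightarrow> real" where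
  "AF_q I \<xi> s = (K1 I \<xi> s)\<^sup>2 / ((K1 I \<xi> s)\<^sup>2 + (K2 I \<xi> s)\<^sup>2)
     * deriv_along I (\<lambda>t. K2 I \<xi> t / K1 I \<xi> t) s"

definition AF_\<sigma> :: "real set \<Rightarrow> (real \<Rightarrow> real^3) \<Rightarrow> real \<Rightarrow> real" where
  "AF_\<sigma> I \<xi> s = (K1 I \<xi> s)\<^sup>2 / ((K1 I \<xi> s)\<^sup>2 + (K2 I \<xi> s)\<^sup>2) powr (3/2)
     * deriv_along I (\<lambda>t. K2 I \<xi> t / K1 I \<xi> t) s"

definition vec_angle :: "'a::real_inner \<Rightarrow> 'a \<Rightarrow> real" where
  "vec_angle u v = arccos (u \<bullet> v / (norm u * norm v))"

text \<open>Like the frames, the property depends on the versor field only, not on the position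
  vector or on the plane field.\<close>

definition darboux_helix :: "real set \<Rightarrow> (real \<Rightarrow> real^3) \<Rightarrow> bool" where
  "darboux_helix I \<xi> \<longleftrightarrow>
     (\<exists>l. norm l = 1 \<and> (\<lambda>s. vec_angle (AF_D I \<xi> s) l) constant_on I)"

end

theory Submission
  imports Defs
begin

text \<open>
  In the alternative frame the principal normal \<open>\<xi>2\<close> and the Darboux
  vector \<open>D\<close> both move in the direction of \<open>Y\<close>: \<open>\<xi>2' = p Y\<close> and \<open>D' = - q Y\<close>. Hence for
  constants \<open>b\<close> and \<open>c\<close>

    \<open>(b \<xi>2 + c D)' = (b p - c q) Y\<close>,

  so that \<open>b \<xi>2 + c D\<close> is a fixed vector precisely when \<open>b p = c q\<close>.

  If \<open>D\<close> makes a constant angle with a unit vector \<open>l\<close>, then \<open>D \<bullet> l\<close> is a constant \<open>c\<close>;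
  differentiating it and using \<open>q \<noteq> 0\<close> gives \<open>Y \<bullet> l = 0\<close>, which makes \<open>\<xi>2 \<bullet> l\<close> a constant \<open>b\<close>
  as well. So \<open>l = b \<xi>2 + c D\<close>, and \<open>b p = c q\<close>. Neither constant can vanish, because \<open>p\<close> and \<open>q\<close>
  do not and \<open>l \<noteq> 0\<close>; therefore \<open>p / q = c / b\<close>. Conversely, if \<open>p / q\<close> is a constant \<open>k\<close>, then
  \<open>\<xi>2 + k D\<close> is a fixed vector, and after normalisation it is the required axis.
  That \<open>p / q\<close> is \<open>1 / \<sigma>\<close> is algebra, and a sign \<open>\<epsilon>\<close> does not affect constancy.

  The equation for \<open>D'\<close> is obtained without differentiating \<open>Y\<close>: with \<open>\<kappa> = K2 / K1\<close> one has
  \<open>D = (\<kappa> \<xi> + \<xi>3) / sqrt (1 + \<kappa>\<^sup>2)\<close>, and the Frenet-type equations reduce the derivative of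
  the numerator to \<open>\<kappa>' \<xi>\<close> (lemmas \<open>frenet_xi2\<close>, \<open>frenet_xi3\<close>, \<open>AF_D_derivative\<close>).
\<close>

section \<open>Orthonormal frames and angles\<close>

lemma cross3_orthonormal:
  fixes a b :: "real^3"
  assumes "norm a = 1" "norm b = 1" "a \<bullet> b = 0"
  shows "norm (cross3 a b) = 1" "cross3 a (cross3 a b) = - b" "cross3 b (cross3 a b) = a"
proof -
  have "(norm (cross3 a b))\<^sup>2 = 1"
    using norm_cross_dot[of a b] assms by simp
  then show "norm (cross3 a b) = 1"
    using power2_eq_imp_eq[of "norm (cross3 a b)" 1] by simp
  have "a \<bullet> a = 1" "b \<bullet> b = 1" "b \<bullet> a = 0"
    using assms by (simp_all add: norm_eq_1 inner_commute)
  then show "cross3 a (cross3 a b) = - b" "cross3 b (cross3 a b) = a"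
    using assms(3) by (simp_all add: Lagrange)
qed

text \<open>The remainder of the expansion is orthogonal to both vectors, hence parallel to their
  product; being orthogonal to the product too, it vanishes.\<close>

lemma cross3_orthonormal_expansion:
  fixes a b v :: "real^3"
  assumes "norm a = 1" "norm b = 1" "a \<bullet> b = 0"
  shows "v = (v \<bullet> a) *\<^sub>R a + (v \<bullet> b) *\<^sub>R b + (v \<bullet> cross3 a b) *\<^sub>R cross3 a b"
proof -
  define n where "n = cross3 a b"
  define w where "w = v - ((v \<bullet> a) *\<^sub>R a + (v \<bullet> b) *\<^sub>R b + (v \<bullet> n) *\<^sub>R n)"
  have nn: "norm n = 1" and orth: "a \<bullet> n = 0" "n \<bullet> a = 0" "b \<bullet> n = 0" "n \<bullet> b = 0"
    using cross3_orthonormal[OF assms] by (simp_all add: n_def dot_cross_self)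
  have unit: "a \<bullet> a = 1" "b \<bullet> b = 1" "n \<bullet> n = 1" "b \<bullet> a = 0"
    using assms nn by (simp_all add: norm_eq_1 inner_commute)
  have w: "w \<bullet> a = 0" "w \<bullet> b = 0" "w \<bullet> n = 0"
    by (simp_all add: w_def inner_diff_left inner_add_left unit orth assms)
  have "cross3 w n = 0"
    using w by (simp add: n_def Lagrange)
  with w(3) have "w = 0 \<or> n = 0"
    using norm_and_cross_eq_0 by blast
  with nn have "w = 0" by auto
  then show ?thesis
    by (simp add: w_def n_def)
qed

text \<open>For unit vectors the cosine lies in the range where \<^const>\<open>arccos\<close> is injective.\<close>

lemma vec_angle_unit_eq_iff:
  fixes u v l :: "'a::real_inner"
  assumes "norm u = 1" "norm v = 1" "norm l = 1"
  shows "vec_angle u l = vec_angle v l \<longleftrightarrow> u \<bullet> l = v \<bullet> l"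
proof -
  have "\<bar>u \<bullet> l\<bar> \<le> 1" "\<bar>v \<bullet> l\<bar> \<le> 1"
    using Cauchy_Schwarz_ineq2[of u l] Cauchy_Schwarz_ineq2[of v l] assms by simp_all
  then show ?thesis
    by (simp add: vec_angle_def assms arccos_eq_iff)
qed

section \<open>Derivatives along a nondegenerate interval\<close>

text \<open>Every point of the interval is a limit point of it, which makes the derivative within the
  interval unique also at end points.\<close>

lemma deriv_along_eqI:
  fixes I :: "real set"
  assumes "is_interval I" "interior I \<noteq> {}" "s \<in> I"
    and "(f has_vector_derivative v) (at s within I)"
  shows "deriv_along I f s = v"
proof -
  have "I \<noteq> {x}" for x
    using assms(2) by auto
  then have "s islimpt I"
    using assms(1,3) connected_imp_perfect is_interval_connected by blast
  then have "at s within I \<noteq> bot"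
    by (simp add: trivial_limit_within)
  then show ?thesis
    unfolding deriv_along_def using assms(4) by (rule vector_derivative_within)
qed

lemma has_vector_derivative_deriv_along:
  assumes "f differentiable_on I" "s \<in> I"
  shows "(f has_vector_derivative deriv_along I f s) (at s within I)"
  using assms unfolding deriv_along_def differentiable_on_def
  by (simp add: vector_derivative_works)

lemma constant_on_mult_left_iff:
  fixes f :: "'a \<Rightarrow> real"
  assumes "a \<noteq> 0"
  shows "(\<lambda>s. a * f s) constant_on S \<longleftrightarrow> f constant_on S"
proof
  assume "(\<lambda>s. a * f s) constant_on S"
  then obtain c where "\<forall>s\<in>S. a * f s = c"
    unfolding constant_on_def by blast
  with assms have "\<forall>s\<in>S. f s = c / a"
    by (auto simp: eq_divide_eq mult.commute)
  then show "f constant_on S"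
    unfolding constant_on_def by blast
next
  assume "f constant_on S"
  then show "(\<lambda>s. a * f s) constant_on S"
    unfolding constant_on_def by auto
qed

lemma has_real_derivative_inverse_sqrt_one_plus_square:
  assumes "(g has_real_derivative m) (at s within I)"
  shows "((\<lambda>t. 1 / sqrt (1 + (g t)\<^sup>2)) has_real_derivative
    - (g s * m / sqrt (1 + (g s)\<^sup>2) ^ 3)) (at s within I)"
proof -
  have pos: "1 + (g s)\<^sup>2 > 0"
    by (simp add: add_pos_nonneg)
  have "((\<lambda>t. sqrt (1 + (g t)\<^sup>2)) has_real_derivative g s * m / sqrt (1 + (g s)\<^sup>2))
      (at s within I)"
    using pos by (auto intro!: derivative_eq_intros assms simp: field_simps)
  moreover have "sqrt (1 + (g s)\<^sup>2) \<noteq> 0"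
    using pos by simp
  ultimately have "((\<lambda>t. inverse (sqrt (1 + (g t)\<^sup>2))) has_real_derivative
      - (inverse (sqrt (1 + (g s)\<^sup>2)) * (g s * m / sqrt (1 + (g s)\<^sup>2))
        * inverse (sqrt (1 + (g s)\<^sup>2)))) (at s within I)"
    by (rule DERIV_inverse')
  then show ?thesis
    by (simp add: inverse_eq_divide power3_eq_cube)
qed

lemma has_vector_derivative_inner_const:
  assumes "(f has_vector_derivative v) F"
  shows "((\<lambda>t. f t \<bullet> l) has_vector_derivative v \<bullet> l) F"
  using bounded_linear.has_vector_derivative[OF bounded_linear_inner_left assms] .

section \<open>The Frenet-type frame\<close>

locale versor_field =
  fixes I :: "real set" and \<xi> :: "real \<Rightarrow> real^3"
  assumes interval: "is_interval I"
    and nondegenerate: "interior I \<noteq> {}"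
    and smooth: "smooth_along I \<xi>"
    and unit: "s \<in> I \<Longrightarrow> norm (\<xi> s) = 1"
    and curved: "s \<in> I \<Longrightarrow> K1 I \<xi> s > 0"
begin

abbreviation (input) d where "d \<equiv> deriv_along I"
abbreviation (input) k1 where "k1 \<equiv> K1 I \<xi>"
abbreviation (input) k2 where "k2 \<equiv> K2 I \<xi>"
abbreviation (input) e2 where "e2 \<equiv> \<xi>2 I \<xi>"
abbreviation (input) e3 where "e3 \<equiv> \<xi>3 I \<xi>"
abbreviation (input) \<kappa> where "\<kappa> \<equiv> \<lambda>t. K2 I \<xi> t / K1 I \<xi> t"
abbreviation (input) p where "p \<equiv> AF_p I \<xi>"
abbreviation (input) q where "q \<equiv> AF_q I \<xi>"
abbreviation (input) Y where "Y \<equiv> AF_Y I \<xi>"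
abbreviation (input) D where "D \<equiv> AF_D I \<xi>"

lemma nonempty: "I \<noteq> {}"
  using nondegenerate by auto

lemmas d_eqI = deriv_along_eqI[OF interval nondegenerate]

lemma derivative_unique:
  assumes "s \<in> I" "(f has_vector_derivative v) (at s within I)"
    "(f has_vector_derivative w) (at s within I)"
  shows "v = w"
  using d_eqI[OF assms(1,2)] d_eqI[OF assms(1,3)] by simp

lemma derivative_zero_constant:
  assumes "\<And>s. s \<in> I \<Longrightarrow> (f has_vector_derivative 0) (at s within I)"
  shows "\<exists>c. \<forall>s\<in>I. f s = c"
  using has_derivative_zero_constant[OF is_interval_convex[OF interval], of f] assms
  by (simp add: has_vector_derivative_def)

lemmas has_d = has_vector_derivative_deriv_along

lemma smooth_xi:
  "\<xi> differentiable_on I" "d \<xi> differentiable_on I" "d (d \<xi>) differentiable_on I"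
  using smooth[unfolded smooth_along_def, rule_format, of 0]
    smooth[unfolded smooth_along_def, rule_format, of 1]
    smooth[unfolded smooth_along_def, rule_format, of 2]
  by (simp_all add: numeral_2_eq_2)

lemma K1_derivative:
  assumes "s \<in> I"
  shows "(k1 has_real_derivative (d \<xi> s \<bullet> d (d \<xi>) s) / k1 s) (at s within I)"
proof -
  have "d \<xi> s \<noteq> 0"
    using curved[OF assms] by (auto simp: K1_def)
  then have "(norm has_derivative (\<lambda>h. h \<bullet> sgn (d \<xi> s))) (at (d \<xi> s))"
    by (rule has_derivative_norm)
  from has_derivative_compose[OF
      has_d[OF smooth_xi(2) assms, unfolded has_vector_derivative_def] this]
  show ?thesis
    unfolding has_field_derivative_def K1_def[abs_def]
    by (rule has_derivative_eq_rhs)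
      (simp add: fun_eq_iff sgn_div_norm inner_commute divide_inverse mult_ac)
qed

lemma K1_differentiable: "k1 differentiable_on I"
  unfolding differentiable_on_def
  using K1_derivative by (blast intro: differentiableI has_field_derivative_imp_has_derivative)

lemma xi2_derivative:
  assumes "s \<in> I"
  shows "(e2 has_vector_derivative
    (1 / k1 s) *\<^sub>R d (d \<xi>) s - ((d \<xi> s \<bullet> d (d \<xi>) s) / k1 s ^ 3) *\<^sub>R d \<xi> s) (at s within I)"
proof -
  have "k1 s \<noteq> 0"
    using curved[OF assms] by simp
  then have inv: "((\<lambda>t. inverse (k1 t)) has_real_derivative
      - ((d \<xi> s \<bullet> d (d \<xi>) s) / k1 s ^ 3)) (at s within I)"
    by (auto intro!: derivative_eq_intros K1_derivative[OF assms]
        simp: field_simps power3_eq_cube)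
  have "((\<lambda>t. inverse (k1 t) *\<^sub>R d \<xi> t) has_vector_derivative
      inverse (k1 s) *\<^sub>R d (d \<xi>) s + (- ((d \<xi> s \<bullet> d (d \<xi>) s) / k1 s ^ 3)) *\<^sub>R d \<xi> s)
      (at s within I)"
    by (rule has_vector_derivative_scaleR[OF inv has_d[OF smooth_xi(2) assms]])
  then show ?thesis
    by (simp add: \<xi>2_def[abs_def] divide_inverse)
qed

text \<open>The torsion is built from \<open>\<xi>2'\<close>, and the alternative curvature \<open>q\<close> from the derivative of
  the torsion, so \<open>\<xi>2\<close> has to be differentiable twice. The explicit derivative provides this.\<close>

lemma xi2_differentiable:
  "e2 differentiable_on I" "d e2 differentiable_on I"
proof -
  show "e2 differentiable_on I"
    unfolding differentiable_on_def
    using xi2_derivative differentiableI_vector by blast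
  have eq: "d e2 t = inverse (k1 t) *\<^sub>R d (d \<xi>) t
      - ((d \<xi> t \<bullet> d (d \<xi>) t) * (inverse (k1 t) * inverse (k1 t) * inverse (k1 t))) *\<^sub>R d \<xi> t" if "t \<in> I" for t
    using d_eqI[OF that xi2_derivative[OF that]] by (simp add: divide_inverse power3_eq_cube mult.assoc)
  have inv: "(\<lambda>t. inverse (k1 t)) differentiable_on I"
    using curved by (intro differentiable_on_inverse K1_differentiable) force
  have "(\<lambda>t. d \<xi> t \<bullet> d (d \<xi>) t) differentiable_on I"
    using smooth_xi by (simp add: differentiable_on_def)
  then have diff: "(\<lambda>t. inverse (k1 t) *\<^sub>R d (d \<xi>) t - ((d \<xi> t \<bullet> d (d \<xi>) t)
      * (inverse (k1 t) * inverse (k1 t) * inverse (k1 t))) *\<^sub>R d \<xi> t) differentiable_on I"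
    (is "?g differentiable_on I")
    by (intro differentiable_on_diff differentiable_on_scaleR differentiable_on_mult
        inv smooth_xi)
  show "d e2 differentiable_on I"
    unfolding differentiable_on_def
  proof
    fix s assume s: "s \<in> I"
    with diff have "?g differentiable (at s within I)"
      unfolding differentiable_on_def by blast
    then show "d e2 differentiable (at s within I)"
      by (rule differentiable_transform_within[OF _ zero_less_one s]) (simp only: eq)
  qed
qed

lemma xi_deriv: "s \<in> I \<Longrightarrow> d \<xi> s = k1 s *\<^sub>R e2 s"
  using curved[of s] by (simp add: \<xi>2_def)

lemma inner_deriv_unit_field:
  assumes "f differentiable_on I" "\<And>t. t \<in> I \<Longrightarrow> norm (f t) = 1" "s \<in> I"
  shows "d f s \<bullet> f s = 0"
proof -
  have "((\<lambda>t. f t \<bullet> f t) has_vector_derivative (f s \<bullet> d f s + d f s \<bullet> f s)) (at s within I)"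
    by (rule bounded_bilinear.has_vector_derivative[OF bounded_bilinear_inner])
      (use has_d[OF assms(1,3)] in auto)
  moreover have "((\<lambda>t. f t \<bullet> f t) has_vector_derivative 0) (at s within I)"
    by (rule has_vector_derivative_transform[OF assms(3) _ has_vector_derivative_const[of 1]])
      (use assms(2) in \<open>simp add: norm_eq_1\<close>)
  ultimately have "f s \<bullet> d f s + d f s \<bullet> f s = 0"
    by (rule derivative_unique[OF assms(3)])
  then show ?thesis
    by (simp add: inner_commute)
qed

lemma frame_orthonormal:
  assumes "s \<in> I"
  shows "norm (e2 s) = 1" "\<xi> s \<bullet> e2 s = 0" "norm (e3 s) = 1"
    "\<xi> s \<bullet> e3 s = 0" "e2 s \<bullet> e3 s = 0"
    "cross3 (\<xi> s) (e3 s) = - e2 s" "cross3 (e2 s) (e3 s) = \<xi> s"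
    "cross3 (e2 s) (\<xi> s) = - e3 s"
proof -
  show n: "norm (e2 s) = 1"
    using curved[OF assms] by (simp add: \<xi>2_def K1_def)
  show o: "\<xi> s \<bullet> e2 s = 0"
    using inner_deriv_unit_field[OF smooth_xi(1) unit assms]
    by (simp add: \<xi>2_def inner_commute)
  show "norm (e3 s) = 1" "\<xi> s \<bullet> e3 s = 0" "e2 s \<bullet> e3 s = 0"
    "cross3 (\<xi> s) (e3 s) = - e2 s" "cross3 (e2 s) (e3 s) = \<xi> s"
    using cross3_orthonormal[OF unit[OF assms] n o] by (simp_all add: \<xi>3_def dot_cross_self)
  show "cross3 (e2 s) (\<xi> s) = - e3 s"
    unfolding \<xi>3_def by (rule cross_skew)
qed

lemma frame_inner:
  assumes "s \<in> I"
  shows "\<xi> s \<bullet> \<xi> s = 1" "e2 s \<bullet> e2 s = 1" "e3 s \<bullet> e3 s = 1"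
    "\<xi> s \<bullet> e2 s = 0" "e2 s \<bullet> \<xi> s = 0" "\<xi> s \<bullet> e3 s = 0" "e3 s \<bullet> \<xi> s = 0"
    "e2 s \<bullet> e3 s = 0" "e3 s \<bullet> e2 s = 0"
  using unit[OF assms] frame_orthonormal[OF assms] by (simp_all add: norm_eq_1 inner_commute)

text \<open>The components of \<open>\<xi>2'\<close> come from differentiating \<open>\<xi> \<bullet> \<xi>2 = 0\<close> and \<open>\<xi>2 \<bullet> \<xi>2 = 1\<close>; the third
  one is the torsion by definition.\<close>

lemma frenet_xi2:
  assumes "s \<in> I"
  shows "d e2 s = - k1 s *\<^sub>R \<xi> s + k2 s *\<^sub>R e3 s"
proof -
  have "((\<lambda>t. \<xi> t \<bullet> e2 t) has_vector_derivative (\<xi> s \<bullet> d e2 s + d \<xi> s \<bullet> e2 s)) (at s within I)"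
    by (rule bounded_bilinear.has_vector_derivative[OF bounded_bilinear_inner])
      (use has_d[OF smooth_xi(1) assms] has_d[OF xi2_differentiable(1) assms] in auto)
  moreover have "((\<lambda>t. \<xi> t \<bullet> e2 t) has_vector_derivative 0) (at s within I)"
    by (rule has_vector_derivative_transform[OF assms _ has_vector_derivative_const[of 0]])
      (simp add: frame_inner)
  ultimately have "\<xi> s \<bullet> d e2 s + d \<xi> s \<bullet> e2 s = 0"
    by (rule derivative_unique[OF assms])
  then have 1: "d e2 s \<bullet> \<xi> s = - k1 s"
    by (simp add: xi_deriv[OF assms] frame_inner[OF assms] inner_commute)
  have 2: "d e2 s \<bullet> e2 s = 0"
    using inner_deriv_unit_field[OF xi2_differentiable(1) _ assms] frame_orthonormal by blast
  show ?thesis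
    using cross3_orthonormal_expansion[OF unit[OF assms] frame_orthonormal(1,2)[OF assms],
        of "d e2 s"] 1 2
    by (simp add: K2_def \<xi>3_def)
qed

lemma frenet_xi3:
  assumes "s \<in> I"
  shows "(e3 has_vector_derivative - k2 s *\<^sub>R e2 s) (at s within I)"
proof -
  have "bounded_bilinear cross3"
    by (simp add: bilinear_conv_bounded_bilinear[symmetric] bilinear_cross)
  then have "((\<lambda>t. cross3 (\<xi> t) (e2 t)) has_vector_derivative
      (cross3 (\<xi> s) (d e2 s) + cross3 (d \<xi> s) (e2 s))) (at s within I)"
    by (rule bounded_bilinear.has_vector_derivative)
      (use has_d[OF smooth_xi(1) assms] has_d[OF xi2_differentiable(1) assms] in auto)
  moreover have "cross3 (\<xi> s) (d e2 s) + cross3 (d \<xi> s) (e2 s) = - k2 s *\<^sub>R e2 s"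
    by (simp add: frenet_xi2[OF assms] xi_deriv[OF assms] Cross3.right_diff_distrib
        cross_mult_right cross_mult_left frame_orthonormal[OF assms])
  ultimately show ?thesis
    by (simp add: \<xi>3_def[abs_def])
qed

lemma ratio_differentiable: "\<kappa> differentiable_on I"
proof -
  have "e3 differentiable_on I"
    unfolding differentiable_on_def using frenet_xi3 differentiableI_vector by blast
  then have "k2 differentiable_on I"
    using xi2_differentiable(2) by (simp add: K2_def[abs_def] differentiable_on_def)
  moreover have "k1 t \<noteq> 0" if "t \<in> I" for t
    using curved[OF that] by simp
  ultimately show ?thesis
    using K1_differentiable by (simp add: differentiable_on_def)
qed

section \<open>The alternative frame\<close>

lemma AF_p_pos: "s \<in> I \<Longrightarrow> p s > 0"
  using curved[of s] by (simp add: AF_p_def add_pos_nonneg)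

lemma AF_p_eq_norm:
  assumes "s \<in> I"
  shows "norm (d e2 s) = p s"
proof -
  have "(norm (d e2 s))\<^sup>2 = (k1 s)\<^sup>2 + (k2 s)\<^sup>2"
    unfolding power2_norm_eq_inner frenet_xi2[OF assms]
    by (simp add: inner_add_left inner_add_right inner_diff_left inner_diff_right
        frame_inner[OF assms] power2_eq_square)
  then show ?thesis
    by (simp add: AF_p_def real_sqrt_unique)
qed

text \<open>Dividing by \<open>K1 > 0\<close> leaves \<open>Y\<close>, \<open>D\<close> and \<open>q\<close> dependent on \<open>K1\<close> and \<open>K2\<close> only through
  \<open>\<kappa> = K2 / K1\<close>, so that \<open>\<kappa>'\<close> is the only derivative of a curvature in the formula for \<open>D'\<close>.\<close>

lemma AF_p_ratio:
  assumes "s \<in> I"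
  shows "p s = k1 s * sqrt (1 + (\<kappa> s)\<^sup>2)"
proof -
  have "(k1 s)\<^sup>2 + (k2 s)\<^sup>2 = (k1 s)\<^sup>2 * (1 + (\<kappa> s)\<^sup>2)"
    using curved[OF assms] by (simp add: field_simps)
  then show ?thesis
    using curved[OF assms] by (simp add: AF_p_def real_sqrt_mult)
qed

lemma AF_q_ratio:
  assumes "s \<in> I"
  shows "q s = d \<kappa> s / (1 + (\<kappa> s)\<^sup>2)"
proof -
  have "(k1 s)\<^sup>2 / ((k1 s)\<^sup>2 + (k2 s)\<^sup>2) = 1 / (1 + (\<kappa> s)\<^sup>2)"
    using curved[OF assms] by (simp add: power_divide add_divide_distrib[symmetric] divide_simps)
  then show ?thesis
    by (simp add: AF_q_def)
qed

lemma AF_Y_ratio: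
  assumes "s \<in> I"
  shows "Y s = (1 / sqrt (1 + (\<kappa> s)\<^sup>2)) *\<^sub>R (\<kappa> s *\<^sub>R e3 s - \<xi> s)"
proof -
  have "d e2 s = k1 s *\<^sub>R (\<kappa> s *\<^sub>R e3 s - \<xi> s)"
    using curved[OF assms] by (simp add: frenet_xi2[OF assms] scaleR_diff_right)
  moreover have "Y s = (1 / p s) *\<^sub>R d e2 s"
    by (simp add: AF_Y_def AF_p_eq_norm[OF assms] divide_inverse)
  ultimately show ?thesis
    using curved[OF assms] by (simp add: AF_p_ratio[OF assms])
qed

lemma AF_D_ratio:
  assumes "s \<in> I"
  shows "D s = (1 / sqrt (1 + (\<kappa> s)\<^sup>2)) *\<^sub>R (\<kappa> s *\<^sub>R \<xi> s + e3 s)"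
  by (simp add: AF_D_def AF_Y_ratio[OF assms] cross_mult_right Cross3.right_diff_distrib
      frame_orthonormal[OF assms])

lemma AF_xi2_derivative:
  assumes "s \<in> I"
  shows "(e2 has_vector_derivative p s *\<^sub>R Y s) (at s within I)"
proof -
  have "p s *\<^sub>R Y s = d e2 s"
    using AF_p_pos[OF assms] by (simp add: AF_Y_def AF_p_eq_norm[OF assms])
  then show ?thesis
    using has_d[OF xi2_differentiable(1) assms] by simp
qed

lemma AF_orthonormal:
  assumes "s \<in> I"
  shows "norm (Y s) = 1" "e2 s \<bullet> Y s = 0" "norm (D s) = 1" "e2 s \<bullet> D s = 0"
proof -
  show Y: "norm (Y s) = 1"
    using AF_p_pos[OF assms] by (simp add: AF_Y_def AF_p_eq_norm[OF assms])
  show o: "e2 s \<bullet> Y s = 0"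
    by (simp add: AF_Y_ratio[OF assms] inner_diff_right frame_inner[OF assms])
  show "norm (D s) = 1" "e2 s \<bullet> D s = 0"
    using cross3_orthonormal(1)[OF frame_orthonormal(1)[OF assms] Y o]
    by (simp_all add: AF_D_def dot_cross_self)
qed

text \<open>The multiples of \<open>\<xi>2\<close> in \<open>(\<kappa> \<xi> + \<xi>3)'\<close> cancel because \<open>\<kappa> K1 = K2\<close>, which leaves \<open>\<kappa>' \<xi>\<close>. The
  derivative of the normalising factor turns this into a vector orthogonal to \<open>D\<close>, a multiple
  of \<open>Y\<close>.\<close>

lemma AF_D_derivative:
  assumes "s \<in> I"
  shows "(D has_vector_derivative - q s *\<^sub>R Y s) (at s within I)"
proof -
  define w where "w = sqrt (1 + (\<kappa> s)\<^sup>2)"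
  have pos: "1 + (\<kappa> s)\<^sup>2 > 0"
    by (simp add: add_pos_nonneg)
  then have w: "w > 0" "w\<^sup>2 = 1 + (\<kappa> s)\<^sup>2"
    by (simp_all add: w_def)
  have \<kappa>: "(\<kappa> has_real_derivative d \<kappa> s) (at s within I)"
    using has_d[OF ratio_differentiable assms]
    by (simp add: has_real_derivative_iff_has_vector_derivative)
  have scale: "((\<lambda>t. 1 / sqrt (1 + (\<kappa> t)\<^sup>2)) has_real_derivative - (\<kappa> s * d \<kappa> s / w ^ 3))
      (at s within I)"
    unfolding w_def by (rule has_real_derivative_inverse_sqrt_one_plus_square[OF \<kappa>])
  have "((\<lambda>t. \<kappa> t *\<^sub>R \<xi> t) has_vector_derivative \<kappa> s *\<^sub>R d \<xi> s + d \<kappa> s *\<^sub>R \<xi> s) (at s within I)"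
    by (rule has_vector_derivative_scaleR[OF \<kappa> has_d[OF smooth_xi(1) assms]])
  from has_vector_derivative_add[OF this frenet_xi3[OF assms]]
  have "((\<lambda>t. \<kappa> t *\<^sub>R \<xi> t + e3 t) has_vector_derivative d \<kappa> s *\<^sub>R \<xi> s) (at s within I)"
    using curved[OF assms] by (simp add: xi_deriv[OF assms])
  from has_vector_derivative_scaleR[OF scale this]
  have deriv: "((\<lambda>t. (1 / sqrt (1 + (\<kappa> t)\<^sup>2)) *\<^sub>R (\<kappa> t *\<^sub>R \<xi> t + e3 t)) has_vector_derivative
      (1 / w) *\<^sub>R d \<kappa> s *\<^sub>R \<xi> s + (- (\<kappa> s * d \<kappa> s / w ^ 3)) *\<^sub>R (\<kappa> s *\<^sub>R \<xi> s + e3 s))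
      (at s within I)"
    unfolding w_def .
  have value_at: "(1 / w) *\<^sub>R d \<kappa> s *\<^sub>R \<xi> s + (- (\<kappa> s * d \<kappa> s / w ^ 3)) *\<^sub>R (\<kappa> s *\<^sub>R \<xi> s + e3 s)
      = - q s *\<^sub>R Y s"
  proof -
    have q: "q s = d \<kappa> s / w\<^sup>2"
      using AF_q_ratio[OF assms] w(2) by simp
    \<comment> \<open>the component along \<open>\<xi>\<close>, simplified by \<open>w\<^sup>2 - \<kappa>\<^sup>2 = 1\<close>\<close>
    have "d \<kappa> s / w - \<kappa> s * d \<kappa> s / w ^ 3 * \<kappa> s = d \<kappa> s * (w\<^sup>2 - (\<kappa> s)\<^sup>2) / w ^ 3"
      using w(1) by (simp add: field_simps power3_eq_cube power2_eq_square)
    then have c1: "d \<kappa> s / w - \<kappa> s * d \<kappa> s / w ^ 3 * \<kappa> s = d \<kappa> s / w ^ 3"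
      using w(2) by simp
    have "(1 / w) *\<^sub>R d \<kappa> s *\<^sub>R \<xi> s + (- (\<kappa> s * d \<kappa> s / w ^ 3)) *\<^sub>R (\<kappa> s *\<^sub>R \<xi> s + e3 s)
      = (d \<kappa> s / w - \<kappa> s * d \<kappa> s / w ^ 3 * \<kappa> s) *\<^sub>R \<xi> s - (\<kappa> s * d \<kappa> s / w ^ 3) *\<^sub>R e3 s"
      by (simp add: scaleR_add_right scaleR_diff_left)
    also have "\<dots> = - q s *\<^sub>R (1 / w) *\<^sub>R (\<kappa> s *\<^sub>R e3 s - \<xi> s)"
      unfolding c1 q using w(1)
      by (simp add: scaleR_diff_right power3_eq_cube power2_eq_square mult_ac)
    finally show ?thesis
      by (simp only: AF_Y_ratio[OF assms] w_def)
  qed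
  show ?thesis
    by (rule has_vector_derivative_transform[OF assms _ deriv[unfolded value_at]])
      (rule AF_D_ratio)
qed

section \<open>Darboux helices\<close>

text \<open>A fixed vector orthogonal to every \<open>Y\<close> is such a combination, so this formula decides which
  vectors can be the axis of a helix.\<close>

lemma AF_combination_derivative:
  assumes "s \<in> I"
  shows "((\<lambda>t. b *\<^sub>R e2 t + c *\<^sub>R D t) has_vector_derivative (b * p s - c * q s) *\<^sub>R Y s)
    (at s within I)"
proof -
  have "((\<lambda>t. b *\<^sub>R e2 t + c *\<^sub>R D t) has_vector_derivative
      b *\<^sub>R p s *\<^sub>R Y s + c *\<^sub>R (- q s *\<^sub>R Y s)) (at s within I)"
    by (rule has_vector_derivative_add[OF
          bounded_linear.has_vector_derivative[OF bounded_linear_scaleR_right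
            AF_xi2_derivative[OF assms]]
          bounded_linear.has_vector_derivative[OF bounded_linear_scaleR_right
            AF_D_derivative[OF assms]]])
  then show ?thesis
    by (simp add: scaleR_diff_left)
qed

lemma darboux_helix_iff_inner:
  "darboux_helix I \<xi> \<longleftrightarrow> (\<exists>l c. norm l = 1 \<and> (\<forall>s\<in>I. D s \<bullet> l = c))"
proof -
  have "(\<lambda>s. vec_angle (D s) l) constant_on I \<longleftrightarrow> (\<exists>c. \<forall>s\<in>I. D s \<bullet> l = c)"
    if "norm l = 1" for l
  proof -
    have eq: "vec_angle (D s) l = vec_angle (D t) l \<longleftrightarrow> D s \<bullet> l = D t \<bullet> l"
      if "s \<in> I" "t \<in> I" for s t
      using that \<open>norm l = 1\<close> by (simp add: vec_angle_unit_eq_iff AF_orthonormal(3))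
    obtain t where "t \<in> I"
      using nonempty by blast
    show ?thesis
    proof
      assume "(\<lambda>s. vec_angle (D s) l) constant_on I"
      then have "vec_angle (D s) l = vec_angle (D t) l" if "s \<in> I" for s
        using that \<open>t \<in> I\<close> by (auto simp: constant_on_def)
      with eq \<open>t \<in> I\<close> show "\<exists>c. \<forall>s\<in>I. D s \<bullet> l = c"
        by blast
    next
      assume "\<exists>c. \<forall>s\<in>I. D s \<bullet> l = c"
      with \<open>norm l = 1\<close> show "(\<lambda>s. vec_angle (D s) l) constant_on I"
        by (auto simp: constant_on_def vec_angle_def AF_orthonormal(3))
    qed
  qed
  then show ?thesis
    unfolding darboux_helix_def by blast
qed

lemma darboux_helix_imp_ratio_constant:
  assumes q: "\<And>s. s \<in> I \<Longrightarrow> q s \<noteq> 0" and "darboux_helix I \<xi>"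
  shows "(\<lambda>s. p s / q s) constant_on I"
proof -
  obtain l c where l: "norm l = 1" and "\<forall>s\<in>I. D s \<bullet> l = c"
    using assms(2) unfolding darboux_helix_iff_inner by blast
  then have c: "D s \<bullet> l = c" if "s \<in> I" for s
    using that by blast
  have Y: "Y s \<bullet> l = 0" if "s \<in> I" for s
  proof -
    have "((\<lambda>t. D t \<bullet> l) has_vector_derivative (- q s *\<^sub>R Y s) \<bullet> l) (at s within I)"
      using AF_D_derivative[OF that] by (rule has_vector_derivative_inner_const)
    moreover have "((\<lambda>t. D t \<bullet> l) has_vector_derivative 0) (at s within I)"
      by (rule has_vector_derivative_transform[OF that c has_vector_derivative_const])
    ultimately have "(- q s *\<^sub>R Y s) \<bullet> l = 0"
      by (rule derivative_unique[OF that])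
    with q[OF that] show ?thesis by simp
  qed
  have "((\<lambda>t. e2 t \<bullet> l) has_vector_derivative 0) (at s within I)" if "s \<in> I" for s
    using has_vector_derivative_inner_const[OF AF_xi2_derivative[OF that], of l] Y[OF that]
    by simp
  then have "\<exists>b. \<forall>s\<in>I. e2 s \<bullet> l = b"
    by (rule derivative_zero_constant)
  then obtain b where "\<forall>s\<in>I. e2 s \<bullet> l = b"
    by blast
  then have b: "e2 s \<bullet> l = b" if "s \<in> I" for s
    using that by blast
  have axis: "b *\<^sub>R e2 s + c *\<^sub>R D s = l" if "s \<in> I" for s
    using cross3_orthonormal_expansion[OF frame_orthonormal(1)[OF that]
        AF_orthonormal(1,2)[OF that], of l] b[OF that] c[OF that] Y[OF that]
    by (simp add: AF_D_def inner_commute)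
  have bc: "b * p s = c * q s" if "s \<in> I" for s
  proof -
    have "((\<lambda>t. b *\<^sub>R e2 t + c *\<^sub>R D t) has_vector_derivative 0) (at s within I)"
      by (rule has_vector_derivative_transform[OF that axis has_vector_derivative_const])
    then have "(b * p s - c * q s) *\<^sub>R Y s = 0"
      by (rule derivative_unique[OF that AF_combination_derivative[OF that]])
    moreover have "Y s \<noteq> 0"
      using AF_orthonormal(1)[OF that] by auto
    ultimately show ?thesis by simp
  qed
  have "b \<noteq> 0" if "s \<in> I" for s
  proof
    assume "b = 0"
    with bc[OF that] q[OF that] have "c = 0" by simp
    with \<open>b = 0\<close> axis[OF that] l show False by simp
  qed
  then have "p s / q s = c / b" if "s \<in> I" for s
    using that bc[OF that] q[OF that] by (simp add: frac_eq_eq mult.commute)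
  then show ?thesis
    by (auto simp: constant_on_def)
qed

lemma ratio_constant_imp_darboux_helix:
  assumes q: "\<And>s. s \<in> I \<Longrightarrow> q s \<noteq> 0" and "(\<lambda>s. p s / q s) constant_on I"
  shows "darboux_helix I \<xi>"
proof -
  obtain k where k: "p s / q s = k" if "s \<in> I" for s
    using assms(2) by (auto simp: constant_on_def)
  \<comment> \<open>the factor that makes \<open>\<xi>2 + k D\<close> a unit vector\<close>
  define b where "b = 1 / sqrt (1 + k\<^sup>2)"
  define f where "f t = b *\<^sub>R e2 t + (b * k) *\<^sub>R D t" for t
  have "(f has_vector_derivative 0) (at s within I)" if "s \<in> I" for s
  proof -
    have "p s = k * q s"
      using k[OF that] q[OF that] by (simp add: divide_eq_eq)
    then show ?thesis
      using AF_combination_derivative[OF that, of b "b * k"] by (simp add: f_def[abs_def])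
  qed
  then have "\<exists>l. \<forall>s\<in>I. f s = l"
    by (rule derivative_zero_constant)
  then obtain l where "\<forall>s\<in>I. f s = l"
    by blast
  then have l: "f s = l" if "s \<in> I" for s
    using that by blast
  have inner: "e2 s \<bullet> e2 s = 1" "D s \<bullet> D s = 1" "e2 s \<bullet> D s = 0" "D s \<bullet> e2 s = 0"
    if "s \<in> I" for s
    using frame_orthonormal(1)[OF that] AF_orthonormal[OF that]
    by (simp_all add: norm_eq_1 inner_commute)
  have "D s \<bullet> l = b * k" if "s \<in> I" for s
    unfolding l[OF that, symmetric] f_def by (simp add: inner_add_right inner[OF that])
  moreover have "norm l = 1"
  proof -
    obtain s where s: "s \<in> I"
      using nonempty by blast
    have "l \<bullet> l = b\<^sup>2 * (1 + k\<^sup>2)"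
      unfolding l[OF s, symmetric] f_def
      by (simp add: inner_add_right inner_add_left inner[OF s] power2_eq_square algebra_simps)
    also have "\<dots> = 1"
      using add_pos_nonneg[of 1 "k\<^sup>2"] by (simp add: b_def power_divide)
    finally show ?thesis
      by (simp add: norm_eq_1)
  qed
  ultimately show ?thesis
    unfolding darboux_helix_iff_inner by blast
qed

text \<open>Both sides are \<open>A powr (3/2) / (K1\<^sup>2 \<kappa>')\<close> for \<open>A = K1\<^sup>2 + K2\<^sup>2\<close>, since
  \<open>A * sqrt A = A powr (3/2)\<close>.\<close>

lemma AF_ratio_eq_inverse_sigma:
  assumes "s \<in> I"
  shows "p s / q s = 1 / AF_\<sigma> I \<xi> s"
proof -
  define A where "A = (k1 s)\<^sup>2 + (k2 s)\<^sup>2"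
  have A: "A > 0"
    using curved[OF assms] by (simp add: A_def add_pos_nonneg)
  have "A powr (3/2) = A powr (1 + 1/2)"
    by simp
  also have "\<dots> = A * sqrt A"
    using A by (simp only: powr_add powr_half_sqrt powr_one)
  finally show ?thesis
    unfolding AF_p_def AF_q_def AF_\<sigma>_def A_def[symmetric]
    by (simp add: mult_ac)
qed

end

theorem theorem10:
  fixes I :: "real set" and r \<xi> :: "real \<Rightarrow> real^3" and P :: "real \<Rightarrow> (real^3) set"
    and \<epsilon> :: real
  assumes "myller_configuration I r \<xi> P"
    and "\<forall>s\<in>I. (K1 I \<xi> s, K2 I \<xi> s) \<noteq> (0, 0)"
    and "\<forall>s\<in>I. AF_q I \<xi> s \<noteq> 0"
    and "\<epsilon> \<in> {-1, 1}"
  shows "(\<forall>s\<in>I. \<epsilon> * (AF_p I \<xi> s / AF_q I \<xi> s) = \<epsilon> * (1 / AF_\<sigma> I \<xi> s)) \<and>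
    (darboux_helix I \<xi> \<longleftrightarrow> (\<lambda>s. \<epsilon> * (AF_p I \<xi> s / AF_q I \<xi> s)) constant_on I)"
proof -
  interpret versor_field I \<xi>
    using assms(1) by unfold_locales (auto simp: myller_configuration_def)
  have "\<epsilon> \<noteq> 0"
    using assms(4) by auto
  then have "(\<lambda>s. \<epsilon> * (AF_p I \<xi> s / AF_q I \<xi> s)) constant_on I
      \<longleftrightarrow> (\<lambda>s. AF_p I \<xi> s / AF_q I \<xi> s) constant_on I"
    by (rule constant_on_mult_left_iff)
  moreover have "darboux_helix I \<xi> \<longleftrightarrow> (\<lambda>s. AF_p I \<xi> s / AF_q I \<xi> s) constant_on I"
  proof
    show "(\<lambda>s. AF_p I \<xi> s / AF_q I \<xi> s) constant_on I" if "darboux_helix I \<xi>"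
      using assms(3) that by (intro darboux_helix_imp_ratio_constant) auto
    show "darboux_helix I \<xi>" if "(\<lambda>s. AF_p I \<xi> s / AF_q I \<xi> s) constant_on I"
      using assms(3) that by (intro ratio_constant_imp_darboux_helix) auto
  qed
  ultimately show ?thesis
    using AF_ratio_eq_inverse_sigma by simp
qed

end
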